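(* Let $n$ be a positive integer and let $S=\{s_1<s_2<\ldots<s_d\}\subseteq[n]$ be an admissible pinnacle set. Then the number $p_S(n)=\#\{\pi\in\mathfrak{S}_n\mid \operatorname{Pin}\pi=S\}$ is given by $$ p_S(n)=2^{n-2d-1}\sum_{B \subseteq D:\ |B|\leq d} (-1)^{b} (d-b)! \left(\prod_{i=0}^{b-1} \left( d+1-i-r_{b-i}\right)\right) \left(\prod_{i=0}^{d} (d+1-i-b_{i+1})^{n_i}\right). $$
   Context: $[n]=\{1,\dots,n\}$ and $\mathfrak{S}_n$ is the set of permutations $\pi=\pi_1\ldots\pi_n$ of $[n]$ in one-line notation. $\operatorname{Pin}\pi=\{\pi_i\mid 2\le i\le n-1,\ \pi_{i-1}<\pi_i>\pi_{i+1}\}$. A set $S$ is an admissible pinnacle set if $S=\operatorname{Pin}\pi$ for some permutation $\pi$. ($d=\#S$; $d=0$ is allowed.) Put $s_0=0$, $s_{d+1}=n+1$, and $n_i=s_{i+1}-s_i-1$ for $0\le i\le d$. Let $D=\{1_l,1_r,2_l,2_r,\ldots,d_l,d_r\}$ be a set of $2d$ formal symbols with the total order $1_l<1_r<2_l<2_r<\cdots<d_l<d_r$; the elements $i_l$ and $i_r$ are said to have rank $i$. For $B\subseteq D$: $b=\#B$; $r_j$ is the rank of the $j$th smallest element of $B$ for $1\le j\le b$; and $b_i$ is the number of elements of $B$ with rank at least $i$ (so $b_1=b$ and $b_{d+1}=0$). *)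

theory Defs
  imports Complex_Main "HOL-Combinatorics.Permutations" "HOL-Library.Product_Lexorder"
begin

text \<open>A permutation of \<open>[n]\<close> is a function \<open>\<pi>\<close> with \<open>\<pi> permutes {1..n}\<close>; its one-line
  notation is \<open>\<pi> 1 \<dots> \<pi> n\<close>.\<close>

definition Pin :: "nat \<Rightarrow> (nat \<Rightarrow> nat) \<Rightarrow> nat set" where
  "Pin n \<pi> = {\<pi> i | i. 2 \<le> i \<and> i \<le> n - 1 \<and> \<pi> (i - 1) < \<pi> i \<and> \<pi> i > \<pi> (i + 1)}"

text \<open>The permutation witnessing admissibility may have any length.\<close>

definition admissible_pinnacle_set :: "nat set \<Rightarrow> bool" where
  "admissible_pinnacle_set S \<longleftrightarrow> (\<exists>m \<pi>. \<pi> permutes {1..m} \<and> Pin m \<pi> = S)"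

definition pinnacle_count :: "nat set \<Rightarrow> nat \<Rightarrow> nat" where
  "pinnacle_count S n = card {\<pi>. \<pi> permutes {1..n} \<and> Pin n \<pi> = S}"

text \<open>\<open>pinn n S i\<close> is \<open>s\<^sub>i\<close> for \<open>0 \<le> i \<le> d + 1\<close>, including \<open>s\<^sub>0 = 0\<close> and \<open>s\<^bsub>d+1\<^esub> = n + 1\<close>.\<close>

definition pinn :: "nat \<Rightarrow> nat set \<Rightarrow> nat \<Rightarrow> nat" where
  "pinn n S i = (0 # sorted_list_of_set S @ [n + 1]) ! i"

text \<open>The subtraction does not truncate when \<open>S \<subseteq> {1..n}\<close> and \<open>i \<le> card S\<close>.\<close>

definition gap :: "nat \<Rightarrow> nat set \<Rightarrow> nat \<Rightarrow> nat" where
  "gap n S i = pinn n S (i + 1) - pinn n S i - 1"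

text \<open>The symbols \<open>i\<^sub>l\<close> and \<open>i\<^sub>r\<close> are encoded as \<open>(i, False)\<close> and \<open>(i, True)\<close>. The
  lexicographic order on pairs (with \<open>False < True\<close>) is then the order
  \<open>1\<^sub>l < 1\<^sub>r < 2\<^sub>l < 2\<^sub>r < \<dots>\<close>, and the rank is the first component.\<close>

type_synonym symbol = "nat \<times> bool"

definition symbols :: "nat \<Rightarrow> symbol set" where
  "symbols d = {1..d} \<times> UNIV"

abbreviation rank :: "symbol \<Rightarrow> nat" where
  "rank \<equiv> fst"

text \<open>\<open>rank_nth B j\<close> is \<open>r\<^sub>j\<close>, with \<open>j\<close> counted from 1, and \<open>num_rank_ge B i\<close> is \<open>b\<^sub>i\<close>.\<close>

definition rank_nth :: "symbol set \<Rightarrow> nat \<Rightarrow> nat" where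
  "rank_nth B j = rank (sorted_list_of_set B ! (j - 1))"

definition num_rank_ge :: "symbol set \<Rightarrow> nat \<Rightarrow> nat" where
  "num_rank_ge B i = card {x \<in> B. rank x \<ge> i}"

end

theory Submission
  imports Defs
begin

text \<open>Let \<open>h\<^sub>m j\<close> be the number of arrangements of \<open>{1..j}\<close> into \<open>m\<close> ordered, possibly empty lists
  whose peaks are the elements of \<open>S\<close> up to \<open>j\<close>, each nonempty list carrying one of two colors; then
  \<open>p\<^sub>S(n) = h\<^sub>1 n / 2\<close>. A maximum \<open>j + 1\<close> that is not a peak can be added in \<open>2 m\<close> ways, so it
  multiplies \<open>h\<^sub>m\<close> by \<open>2 m\<close>. A maximum that is a peak joins two adjacent nonempty lists into one
  of the \<open>m\<close> lists, which by inclusion-exclusion gives \<open>m/2 (h\<^bsub>m+1\<^esub> - 2 h\<^sub>m + h\<^bsub>m-1\<^esub>)\<close>. Unrolling this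
  second difference backwards from \<open>m = 1\<close>, each pinnacle \<open>s\<^sub>i\<close> replaces \<open>m\<close> by \<open>m + 1\<close> minus the
  number of chosen symbols among \<open>i\<^sub>l, i\<^sub>r\<close>. So the choices form a set \<open>B\<close>, the index reached at stage \<open>i\<close>
  is \<open>d + 1 - i - b\<^bsub>i+1\<^esub>\<close>, and the product of the factors \<open>m\<close> over the pinnacles is rewritten in
  terms of the ranks in \<open>B\<close>.\<close>

section \<open>Subset convolution\<close>

text \<open>The product of set functions that underlies the multiplication of exponential generating
  functions.\<close>

definition subset_conv :: "('a set \<Rightarrow> 'b::comm_semiring_1) \<Rightarrow> ('a set \<Rightarrow> 'b) \<Rightarrow> 'a set \<Rightarrow> 'b" where
  "subset_conv f g A = (\<Sum>T\<in>Pow A. f T * g (A - T))"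

text \<open>For finite \<open>A\<close>, the value at \<open>A\<close> sums, over all ordered
  partitions of \<open>A\<close> into \<open>m\<close> possibly empty blocks, the product of the
  values of \<open>f\<close> on the blocks. The unit is the indicator of the empty set.\<close>

primrec conv_pow :: "('a set \<Rightarrow> 'b::comm_semiring_1) \<Rightarrow> nat \<Rightarrow> 'a set \<Rightarrow> 'b" where
  "conv_pow f 0 = (\<lambda>A. if A = {} then 1 else 0)"
| "conv_pow f (Suc m) = subset_conv f (conv_pow f m)"

lemma sum_Pow_insert:
  assumes "finite A" "x \<notin> A"
  shows "sum g (Pow (insert x A)) = (\<Sum>B\<in>Pow A. g B + g (insert x B))"
proof -
  have "inj_on (insert x) (Pow A)"
    using assms(2) by (auto simp: inj_on_def)
  moreover have "Pow A \<inter> insert x ` Pow A = {}"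
    using assms(2) by auto
  ultimately show ?thesis
    using assms(1) by (simp add: Pow_insert sum.union_disjoint sum.reindex sum.distrib)
qed

lemma subset_conv_cong:
  assumes "\<And>T. T \<subseteq> A \<Longrightarrow> f T = f' T" "\<And>T. T \<subseteq> A \<Longrightarrow> g T = g' T"
  shows "subset_conv f g A = subset_conv f' g' A"
  unfolding subset_conv_def using assms by (intro sum.cong) auto

text \<open>The new point lies in the second block or in the first. This is the Leibniz rule for the
  operator taking \<open>f\<close> to \<open>\<lambda>B. f (insert x B)\<close>.\<close>

lemma subset_conv_insert:
  assumes "finite A" "x \<notin> A"
  shows "subset_conv f g (insert x A) =
    subset_conv f (\<lambda>B. g (insert x B)) A + subset_conv (\<lambda>B. f (insert x B)) g A"
proof -
  have "f T * g (insert x A - T) + f (insert x T) * g (insert x A - insert x T) =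
      f T * g (insert x (A - T)) + f (insert x T) * g (A - T)" if "T \<in> Pow A" for T
  proof -
    have "insert x A - T = insert x (A - T)" "insert x A - insert x T = A - T"
      using that assms(2) by auto
    then show ?thesis by simp
  qed
  then show ?thesis
    using assms by (simp add: subset_conv_def sum_Pow_insert sum.distrib)
qed

text \<open>Both sides sum over the ordered splittings of \<open>A\<close> into three blocks,
  recorded either as \<open>U\<close>, \<open>T - U\<close>, \<open>A - T\<close> or as
  \<open>U\<close>, \<open>V\<close>, \<open>A - U - V\<close>.\<close>

lemma subset_conv_assoc:
  assumes "finite A"
  shows "subset_conv (subset_conv f g) k A = subset_conv f (subset_conv g k) A"
proof -
  have fin: "finite T" if "T \<in> Pow A" for T
    using that assms finite_subset by auto
  have eq: "A - U - (T - U) = A - T" if "U \<subseteq> T" for T U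
    using that by auto
  have "subset_conv (subset_conv f g) k A =
      (\<Sum>(T, U)\<in>(SIGMA T:Pow A. Pow T). f U * g (T - U) * k (A - T))"
    using assms fin by (simp add: subset_conv_def sum_distrib_right sum.Sigma)
  also have "\<dots> = (\<Sum>(U, V)\<in>(SIGMA U:Pow A. Pow (A - U)). f U * (g V * k (A - U - V)))"
    by (rule sum.reindex_bij_witness
        [where i = "\<lambda>(U, V). (U \<union> V, U)" and j = "\<lambda>(T, U). (U, T - U)"])
      (auto simp: mult.assoc Un_absorb1 eq)
  also have "\<dots> = subset_conv f (subset_conv g k) A"
    using assms by (simp add: subset_conv_def sum_distrib_left sum.Sigma)
  finally show ?thesis .
qed

lemma conv_pow_0_left:
  assumes "finite A"
  shows "subset_conv (conv_pow f 0) g A = g A"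
proof -
  have "subset_conv (conv_pow f 0) g A = (\<Sum>T\<in>Pow A. if {} = T then g A else 0)"
    unfolding subset_conv_def by (intro sum.cong) auto
  then show ?thesis using assms by simp
qed

lemma conv_pow_add:
  assumes "finite A"
  shows "subset_conv (conv_pow f a) (conv_pow f b) A = conv_pow f (a + b) A"
  using assms
proof (induction a arbitrary: A)
  case 0
  then show ?case using conv_pow_0_left by auto
next
  case (Suc a)
  then show ?case
    by (auto simp: subset_conv_assoc intro!: subset_conv_cong dest: finite_subset)
qed

lemma conv_pow_1: "finite A \<Longrightarrow> conv_pow f (Suc 0) A = f A"
proof -
  assume "finite A"
  have "conv_pow f (Suc 0) A = (\<Sum>T\<in>Pow A. if A = T then f A else 0)"
    unfolding conv_pow.simps subset_conv_def by (intro sum.cong) auto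
  then show ?thesis using \<open>finite A\<close> by simp
qed

lemma conv_pow_empty: "f {} = 1 \<Longrightarrow> conv_pow f m {} = 1"
  by (induction m) (simp_all add: subset_conv_def)

lemma subset_conv_linear:
  fixes f g :: "'a set \<Rightarrow> 'b::comm_ring_1"
  shows "subset_conv f (\<lambda>B. c * g B) A = c * subset_conv f g A"
    "subset_conv (\<lambda>B. c * f B) g A = c * subset_conv f g A"
    "subset_conv f (\<lambda>B. g B + g' B) A = subset_conv f g A + subset_conv f g' A"
    "subset_conv (\<lambda>B. f B + f' B) g A = subset_conv f g A + subset_conv f' g A"
    "subset_conv f (\<lambda>B. g B - g' B) A = subset_conv f g A - subset_conv f g' A"
    "subset_conv (\<lambda>B. f B - f' B) g A = subset_conv f g A - subset_conv f' g A"
  by (simp_all add: subset_conv_def sum_distrib_left sum.distrib sum_subtractf algebra_simps)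

text \<open>Adjoining a new point \<open>x\<close> is a derivation of the convolution algebra, which turns the
  behaviour of \<open>w\<close> under \<open>insert x\<close> into that of its powers.\<close>

lemma conv_pow_insert_double:
  fixes w :: "'a set \<Rightarrow> rat"
  assumes "finite A" "x \<notin> A" and "\<And>T. T \<subseteq> A \<Longrightarrow> w (insert x T) = 2 * w T"
  shows "conv_pow w m (insert x A) = 2 * of_nat m * conv_pow w m A"
  using assms
proof (induction m arbitrary: A)
  case (Suc m)
  have "subset_conv w (\<lambda>B. conv_pow w m (insert x B)) A =
      subset_conv w (\<lambda>B. 2 * of_nat m * conv_pow w m B) A"
    using Suc by (intro subset_conv_cong Suc.IH) (auto dest: finite_subset)
  moreover have "subset_conv (\<lambda>B. w (insert x B)) (conv_pow w m) A =
      subset_conv (\<lambda>B. 2 * w B) (conv_pow w m) A"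
    using Suc.prems by (intro subset_conv_cong) auto
  ultimately show ?case
    using Suc.prems
    by (simp add: subset_conv_insert subset_conv_linear(1,2)) (simp add: algebra_simps)
qed simp

text \<open>Formally, the derivative of a power \<open>w^m\<close> is \<open>m w^(m-1)\<close> times
  the derivative of \<open>w\<close>, which here is \<open>(w^2 - 2 w + 1) / 2\<close>. The exponent
  is written \<open>Suc m\<close> so that the lowest power that occurs is \<open>m\<close>.\<close>

lemma conv_pow_insert_second_difference:
  fixes w :: "'a set \<Rightarrow> rat"
  assumes "finite A" "x \<notin> A"
    and "\<And>T. T \<subseteq> A \<Longrightarrow>
      w (insert x T) = 1 / 2 * (conv_pow w 2 T - 2 * conv_pow w 1 T + conv_pow w 0 T)"
  shows "conv_pow w (Suc m) (insert x A) = of_nat (Suc m) / 2 *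
    (conv_pow w (Suc (Suc m)) A - 2 * conv_pow w (Suc m) A + conv_pow w m A)"
  using assms
proof (induction m arbitrary: A)
  case 0
  then show ?case
    using conv_pow_1[of "insert x A" w] by (simp add: numeral_2_eq_2 field_simps)
next
  case (Suc m)
  have "subset_conv w (\<lambda>B. conv_pow w (Suc m) (insert x B)) A =
      subset_conv w (\<lambda>B. of_nat (Suc m) / 2 *
        (conv_pow w (Suc (Suc m)) B - 2 * conv_pow w (Suc m) B + conv_pow w m B)) A"
    using Suc.prems by (intro subset_conv_cong Suc.IH) (auto dest: finite_subset)
  also have "\<dots> = of_nat (Suc m) / 2 *
      (conv_pow w (Suc (Suc (Suc m))) A - 2 * conv_pow w (Suc (Suc m)) A + conv_pow w (Suc m) A)"
    by (simp only: subset_conv_linear conv_pow.simps(2))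
  finally have 1: "subset_conv w (\<lambda>B. conv_pow w (Suc m) (insert x B)) A = \<dots>" .
  have "subset_conv (\<lambda>B. w (insert x B)) (conv_pow w (Suc m)) A =
      subset_conv (\<lambda>B. 1 / 2 * (conv_pow w 2 B - 2 * conv_pow w 1 B + conv_pow w 0 B))
        (conv_pow w (Suc m)) A"
    using Suc.prems by (intro subset_conv_cong) auto
  also have "\<dots> = 1 / 2 *
      (conv_pow w (2 + Suc m) A - 2 * conv_pow w (1 + Suc m) A + conv_pow w (0 + Suc m) A)"
    by (simp only: subset_conv_linear conv_pow_add[OF Suc.prems(1)])
  finally have 2: "subset_conv (\<lambda>B. w (insert x B)) (conv_pow w (Suc m)) A = \<dots>" .
  show ?case
    unfolding conv_pow.simps(2)[of w "Suc m"] subset_conv_insert[OF Suc.prems(1,2)] 1 2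
    unfolding conv_pow.simps(2)[symmetric] by (simp del: conv_pow.simps add: field_simps)
qed

section \<open>Lists with prescribed peaks\<close>

fun peaks :: "nat list \<Rightarrow> nat set" where
  "peaks (x # y # z # zs) = (if x < y \<and> z < y then {y} else {}) \<union> peaks (y # z # zs)"
| "peaks _ = {}"

lemma peaks_subset: "peaks xs \<subseteq> set xs"
  by (induction xs rule: peaks.induct) auto

text \<open>The entries next to \<open>M\<close> are ends of \<open>L\<close> and \<open>R\<close>,
  hence no peaks there, and their larger neighbour \<open>M\<close> keeps them from becoming peaks.
  All other entries of \<open>L\<close> and \<open>R\<close> keep their neighbours.\<close>

lemma peaks_append_max:
  assumes "\<forall>x\<in>set L. x < M" "\<forall>x\<in>set R. x < M"
  shows "peaks (L @ M # R) = peaks L \<union> peaks R \<union> (if L = [] \<or> R = [] then {} else {M})"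
  using assms
proof (induction L rule: peaks.induct)
  case (1 x y z zs)
  then show ?case by auto
next
  case "2_1"
  then show ?case by (cases R rule: peaks.cases) auto
next
  case ("2_2" v)
  then show ?case by (cases R rule: peaks.cases) auto
next
  case ("2_3" v va)
  then show ?case by (cases R rule: peaks.cases) auto
qed

lemma peaks_conv_nth:
  "peaks xs = {xs ! i | i. 0 < i \<and> Suc i < length xs \<and> xs ! (i - 1) < xs ! i \<and> xs ! Suc i < xs ! i}"
proof (induction xs rule: peaks.induct)
  case (1 x y z zs)
  let ?P = "\<lambda>xs i. 0 < i \<and> Suc i < length xs \<and> xs ! (i - 1) < xs ! i \<and> xs ! Suc i < xs ! i"
  have P: "?P (x # y # z # zs) i \<longleftrightarrow> i = 1 \<and> x < y \<and> z < y \<or> (\<exists>k. i = Suc k \<and> ?P (y # z # zs) k)" for i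
    by (cases i; cases "i - 1") auto
  have "{f i | i. i = 1 \<and> c \<or> (\<exists>k. i = Suc k \<and> Q k)} =
      (if c then {f 1} else {}) \<union> {f (Suc k) | k. Q k}" for f :: "nat \<Rightarrow> nat" and c Q
    by auto
  note this[of "(!) (x # y # z # zs)" "x < y \<and> z < y" "?P (y # z # zs)", folded P]
  then show ?case using 1 by simp
qed auto

text \<open>Intersecting with \<open>A\<close> lets one fixed \<open>S\<close> prescribe the peaks
  of every block of a partition independently.\<close>

definition peak_lists :: "nat set \<Rightarrow> nat set \<Rightarrow> nat list set" where
  "peak_lists S A = {xs. distinct xs \<and> set xs = A \<and> peaks xs = S \<inter> A}"

lemma finite_peak_lists: "finite A \<Longrightarrow> finite (peak_lists S A)"
  by (rule finite_subset[OF _ finite_subset_distinct[of A]]) (auto simp: peak_lists_def)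

lemma peak_lists_empty: "peak_lists S {} = {[]}"
  by (auto simp: peak_lists_def)

lemma append_max_in_peak_lists_iff:
  assumes "\<forall>x\<in>A. x < M"
  shows "L @ M # R \<in> peak_lists S (insert M A) \<longleftrightarrow> distinct (L @ R) \<and> set L \<union> set R = A \<and>
    peaks L \<union> peaks R \<union> (if L = [] \<or> R = [] then {} else {M}) = S \<inter> insert M A"
proof -
  have "M \<notin> A" using assms by auto
  then have "distinct (L @ M # R) \<and> set (L @ M # R) = insert M A \<longleftrightarrow>
      distinct (L @ R) \<and> set L \<union> set R = A"
    by auto
  moreover have "peaks (L @ M # R) = peaks L \<union> peaks R \<union> (if L = [] \<or> R = [] then {} else {M})"
    if "set L \<union> set R = A"
    using that assms by (intro peaks_append_max) auto
  ultimately show ?thesis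
    unfolding peak_lists_def mem_Collect_eq by metis
qed

lemma peak_lists_insert_cases:
  assumes "xs \<in> peak_lists S (insert M A)"
  obtains L R where "xs = L @ M # R"
  using assms split_list[of M xs] unfolding peak_lists_def by auto

text \<open>A maximum with neighbours on both sides is a peak, so \<open>M\<close> has to stand at
  an end. The two ends give the same list exactly when \<open>A\<close> is empty.\<close>

lemma card_peak_lists_insert_nonpeak:
  assumes "finite A" "\<forall>x\<in>A. x < M" "M \<notin> S"
  shows "card (peak_lists S (insert M A)) = (if A = {} then 1 else 2 * card (peak_lists S A))"
proof -
  let ?P = "peak_lists S A"
  have M: "M \<notin> A" using assms(2) by auto
  have eq: "peak_lists S (insert M A) = (#) M ` ?P \<union> (\<lambda>xs. xs @ [M]) ` ?P"
  proof (intro equalityI subsetI)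
    fix xs assume xs: "xs \<in> peak_lists S (insert M A)"
    then obtain L R where LR: "xs = L @ M # R" by (rule peak_lists_insert_cases)
    note * = xs[unfolded LR append_max_in_peak_lists_iff[OF assms(2)]]
    then have "L = [] \<or> R = []"
      using assms(3) by (auto split: if_splits)
    then show "xs \<in> (#) M ` ?P \<union> (\<lambda>xs. xs @ [M]) ` ?P"
      using * LR assms(3) by (auto simp: peak_lists_def)
  next
    fix xs assume "xs \<in> (#) M ` ?P \<union> (\<lambda>xs. xs @ [M]) ` ?P"
    then obtain L R where *: "xs = L @ M # R" "L = [] \<and> R \<in> ?P \<or> L \<in> ?P \<and> R = []"
      by force
    then show "xs \<in> peak_lists S (insert M A)"
      using assms(3) unfolding *(1) append_max_in_peak_lists_iff[OF assms(2)]
      by (auto simp: peak_lists_def)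
  qed
  show ?thesis
  proof (cases "A = {}")
    case True
    then show ?thesis unfolding eq by (simp add: peak_lists_empty)
  next
    case False
    have "(#) M ` ?P \<inter> (\<lambda>xs. xs @ [M]) ` ?P = {}"
    proof -
      have "M # xs \<noteq> ys @ [M]" if "ys \<in> ?P" for xs ys
        using that M False by (cases ys) (auto simp: peak_lists_def)
      then show ?thesis by auto
    qed
    then have "card (peak_lists S (insert M A)) = card ((#) M ` ?P) + card ((\<lambda>xs. xs @ [M]) ` ?P)"
      unfolding eq using assms(1) by (simp add: card_Un_disjoint finite_peak_lists)
    also have "\<dots> = card ?P + card ?P"
      by (intro arg_cong2[of _ _ _ _ "(+)"] card_image) (auto simp: inj_on_def)
    finally show ?thesis using False by simp
  qed
qed

text \<open>Cutting at \<open>M\<close> is a bijection onto pairs of lists over complementary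
  subsets. Both are nonempty because \<open>M\<close> is a peak, whence the exclusion of
  \<open>{}\<close> and \<open>A\<close>.\<close>

lemma card_peak_lists_insert_peak:
  assumes "finite A" "\<forall>x\<in>A. x < M" "M \<in> S"
  shows "card (peak_lists S (insert M A)) =
    (\<Sum>T\<in>Pow A - {{}, A}. card (peak_lists S T) * card (peak_lists S (A - T)))"
proof -
  let ?P = "peak_lists S"
  let ?X = "SIGMA T:Pow A - {{}, A}. ?P T \<times> ?P (A - T)"
  have M: "M \<notin> A" using assms(2) by auto
  have "bij_betw (\<lambda>(T, L, R). L @ M # R) ?X (?P (insert M A))"
  proof (rule bij_betw_imageI)
    show "inj_on (\<lambda>(T, L, R). L @ M # R) ?X"
    proof (rule inj_onI)
      fix p q
      assume pq: "p \<in> ?X" "q \<in> ?X" "(case p of (T, L, R) \<Rightarrow> L @ M # R) = (case q of (T, L, R) \<Rightarrow> L @ M # R)"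
      obtain T L R T' L' R' where eq: "p = (T, L, R)" "q = (T', L', R')"
        by (metis prod_cases3)
      have *: "T \<subseteq> A" "L \<in> ?P T" "R \<in> ?P (A - T)" "T' \<subseteq> A" "L' \<in> ?P T'" "R' \<in> ?P (A - T')"
        "L @ M # R = L' @ M # R'"
        using pq unfolding eq by auto
      then have "M \<notin> set L" "M \<notin> set R" "M \<notin> set L'" "M \<notin> set R'"
        using M by (auto simp: peak_lists_def)
      then have "L = L' \<and> R = R'"
        using *(7) by (metis append_Cons_eq_iff)
      then show "p = q"
        using * unfolding eq by (auto simp: peak_lists_def)
    qed
  next
    show "(\<lambda>(T, L, R). L @ M # R) ` ?X = ?P (insert M A)"
    proof (intro equalityI subsetI)
      fix xs assume "xs \<in> (\<lambda>(T, L, R). L @ M # R) ` ?X"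
      then obtain T L R where *: "xs = L @ M # R" "T \<subseteq> A" "T \<noteq> {}" "T \<noteq> A"
        "L \<in> ?P T" "R \<in> ?P (A - T)" by auto
      then have "L \<noteq> []" "R \<noteq> []" by (auto simp: peak_lists_def)
      then show "xs \<in> ?P (insert M A)"
        using * assms(3) unfolding *(1) append_max_in_peak_lists_iff[OF assms(2)]
        by (auto simp: peak_lists_def)
    next
      fix xs assume xs: "xs \<in> ?P (insert M A)"
      then obtain L R where LR: "xs = L @ M # R" by (rule peak_lists_insert_cases)
      note * = xs[unfolded LR append_max_in_peak_lists_iff[OF assms(2)]]
      have "L \<noteq> [] \<and> R \<noteq> []"
        using * M assms(3) peaks_subset[of L] peaks_subset[of R] by (auto split: if_splits)
      moreover have "set R = A - set L" "set L \<subseteq> A" using * by auto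
      \<comment> \<open>Intersect the equation for the peaks of the whole list with
        \<open>set L\<close> and with \<open>set R\<close>, which are disjoint and do not contain
        \<open>M\<close>.\<close>
      moreover have "peaks L = S \<inter> set L" "peaks R = S \<inter> set R"
        using * calculation M peaks_subset[of L] peaks_subset[of R] by (auto split: if_splits)
      ultimately have "(set L, L, R) \<in> ?X"
        using * by (auto simp: peak_lists_def)
      then show "xs \<in> (\<lambda>(T, L, R). L @ M # R) ` ?X"
        unfolding LR by (intro image_eqI[of _ _ "(set L, L, R)"]) simp_all
    qed
  qed
  then have "card (?P (insert M A)) = card ?X"
    by (rule bij_betw_same_card[symmetric])
  also have "\<dots> = (\<Sum>T\<in>Pow A - {{}, A}. card (?P T) * card (?P (A - T)))"
  proof -
    have "finite (?P T)" if "T \<subseteq> A" for T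
      using that assms(1) by (intro finite_peak_lists) (rule finite_subset)
    then show ?thesis
      using assms(1) by (subst card_SigmaI) (auto simp: card_cartesian_product)
  qed
  finally show ?thesis .
qed

text \<open>The weight \<open>2\<close> per nonempty set makes non-peaks act uniformly: a new maximum that is not a
  peak can be put at either end of a list, while on the empty list the two choices coincide.\<close>

definition peak_weight :: "nat set \<Rightarrow> nat set \<Rightarrow> rat" where
  "peak_weight S A = (if A = {} then 1 else 2 * of_nat (card (peak_lists S A)))"

lemma peak_weight_insert_nonpeak:
  assumes "finite A" "\<forall>x\<in>A. x < M" "M \<notin> S"
  shows "peak_weight S (insert M A) = 2 * peak_weight S A"
  using card_peak_lists_insert_nonpeak[OF assms] by (simp add: peak_weight_def)

text \<open>For nonempty \<open>A\<close>, the terms \<open>T = {}\<close> and \<open>T = A\<close>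
  contribute \<open>2 w(A)\<close> to the square of the weight \<open>w\<close>, and the power
  \<open>0\<close> vanishes. The terms left carry a factor \<open>4\<close>, of which the new weight
  uses \<open>2\<close>. For empty \<open>A\<close> both sides are \<open>0\<close>, as a single
  entry is no peak and \<open>1 - 2 + 1 = 0\<close>.\<close>

lemma peak_weight_insert_peak:
  assumes "finite A" "\<forall>x\<in>A. x < M" "M \<in> S"
  shows "peak_weight S (insert M A) = 1 / 2 * (conv_pow (peak_weight S) 2 A -
    2 * conv_pow (peak_weight S) 1 A + conv_pow (peak_weight S) 0 A)"
proof (cases "A = {}")
  case True
  have "peak_weight S {} = 1" by (simp add: peak_weight_def)
  then have "conv_pow (peak_weight S) m {} = 1" for m
    by (rule conv_pow_empty)
  then show ?thesis
    using True card_peak_lists_insert_peak[OF assms] by (simp add: peak_weight_def del: conv_pow.simps)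
next
  case False
  let ?w = "peak_weight S"
  have w0: "?w {} = 1" by (simp add: peak_weight_def)
  have w1: "conv_pow ?w 1 A = ?w A"
    using assms(1) conv_pow_1 by simp
  have "conv_pow ?w 2 A = subset_conv ?w ?w A"
    unfolding numeral_2_eq_2 conv_pow.simps(2)[of ?w "Suc 0"]
    using assms(1) by (intro subset_conv_cong conv_pow_1) (auto dest: finite_subset)
  also have "\<dots> = (\<Sum>T\<in>Pow A - {{}, A}. ?w T * ?w (A - T)) + (\<Sum>T\<in>{{}, A}. ?w T * ?w (A - T))"
    unfolding subset_conv_def using assms(1) by (intro sum.subset_diff) auto
  also have "(\<Sum>T\<in>{{}, A}. ?w T * ?w (A - T)) = 2 * ?w A"
    using False w0 by simp
  also have "(\<Sum>T\<in>Pow A - {{}, A}. ?w T * ?w (A - T)) =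
      (\<Sum>T\<in>Pow A - {{}, A}. 4 * of_nat (card (peak_lists S T) * card (peak_lists S (A - T))))"
    by (intro sum.cong) (auto simp: peak_weight_def)
  also have "\<dots> = 2 * ?w (insert M A)"
    using card_peak_lists_insert_peak[OF assms] by (simp add: peak_weight_def sum_distrib_left)
  finally show ?thesis using False w1 by simp
qed

section \<open>Passage from permutations to lists in one-line notation\<close>

lemma pinnacle_count_eq_card_peak_lists: "pinnacle_count S n = card (peak_lists S {1..n})"
  if "S \<subseteq> {1..n}"
proof -
  let ?f = "\<lambda>\<pi>. map \<pi> [1..<Suc n]"
  \<comment> \<open>The inverse of \<open>?f\<close>; outside \<open>{1..n}\<close> it is the
    identity, as \<open>permutes\<close> demands.\<close>
  let ?g = "\<lambda>xs i. if i \<in> {1..n} then xs ! (i - 1) else i"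
  have nth: "?f \<pi> ! i = \<pi> (Suc i)" if "i < n" for \<pi> :: "nat \<Rightarrow> nat" and i
    using that by (subst nth_map) (auto simp del: upt_Suc)
  have Pin: "Pin n \<pi> = peaks (?f \<pi>)" for \<pi> :: "nat \<Rightarrow> nat"
  proof (intro equalityI subsetI)
    fix y assume "y \<in> Pin n \<pi>"
    then obtain i where i: "y = \<pi> i" "2 \<le> i" "i \<le> n - 1" "\<pi> (i - 1) < \<pi> i" "\<pi> i > \<pi> (i + 1)"
      unfolding Pin_def by auto
    \<comment> \<open>Lists are indexed from \<open>0\<close> and permutations from
      \<open>1\<close>, so position \<open>i\<close> of \<open>\<pi>\<close> is index
      \<open>Suc k\<close> of the list. Writing \<open>i\<close> with two successors removes the
      truncated subtractions.\<close>
    define k where "k = i - 2"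
    have "i = Suc (Suc k)" using i(2) by (simp add: k_def)
    then show "y \<in> peaks (?f \<pi>)"
      unfolding peaks_conv_nth mem_Collect_eq using i
      by (intro exI[of _ "Suc k"]) (simp add: nth del: upt_Suc)
  next
    fix y assume "y \<in> peaks (?f \<pi>)"
    then obtain i where i: "y = ?f \<pi> ! i" "0 < i" "Suc i < length (?f \<pi>)"
        "?f \<pi> ! (i - 1) < ?f \<pi> ! i" "?f \<pi> ! Suc i < ?f \<pi> ! i"
      unfolding peaks_conv_nth by auto
    define k where "k = i - 1"
    have "i = Suc k" using i(2) by (simp add: k_def)
    then show "y \<in> Pin n \<pi>"
      unfolding Pin_def mem_Collect_eq using i
      by (intro exI[of _ "Suc (Suc k)"]) (simp add: nth del: upt_Suc)
  qed
  have "bij_betw ?f {\<pi>. \<pi> permutes {1..n} \<and> Pin n \<pi> = S} (peak_lists S {1..n})"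
  proof (rule bij_betw_byWitness[where f' = ?g])
    show "\<forall>\<pi>\<in>{\<pi>. \<pi> permutes {1..n} \<and> Pin n \<pi> = S}. ?g (?f \<pi>) = \<pi>"
    proof (clarify, rule ext)
      fix \<pi> i assume \<pi>: "\<pi> permutes {1..n}"
      show "?g (?f \<pi>) i = \<pi> i"
      proof (cases "i \<in> {1..n}")
        case True
        then have "i - 1 < n" "Suc (i - 1) = i" by auto
        then show ?thesis using True by (simp only: nth if_True)
      next
        case False
        then show ?thesis using permutes_not_in[OF \<pi> False] by (simp only: if_False)
      qed
    qed
    have fg: "?f (?g xs) = xs" if "length xs = n" for xs
      using that nth by (intro nth_equalityI) (auto simp del: upt_Suc)
    have len: "length xs = n" if "xs \<in> peak_lists S {1..n}" for xs
      using that distinct_card[of xs] by (simp add: peak_lists_def)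
    show "\<forall>xs\<in>peak_lists S {1..n}. ?f (?g xs) = xs"
      using fg len by blast
    show "?f ` {\<pi>. \<pi> permutes {1..n} \<and> Pin n \<pi> = S} \<subseteq> peak_lists S {1..n}"
    proof clarify
      fix \<pi> assume \<pi>: "\<pi> permutes {1..n}" and S: "S = Pin n \<pi>"
      have "set [1..<Suc n] = {1..n}" by auto
      moreover have "\<pi> ` {1..n} = {1..n}" "inj_on \<pi> {1..n}"
        using \<pi> by (auto simp: permutes_image permutes_inj_on)
      ultimately show "?f \<pi> \<in> peak_lists (Pin n \<pi>) {1..n}"
        using that unfolding S peak_lists_def mem_Collect_eq Pin[symmetric]
        by (auto simp: distinct_map simp del: upt_Suc)
    qed
    show "?g ` peak_lists S {1..n} \<subseteq> {\<pi>. \<pi> permutes {1..n} \<and> Pin n \<pi> = S}"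
    proof clarify
      fix xs assume xs: "xs \<in> peak_lists S {1..n}"
      have "peaks xs = S" using xs that by (auto simp: peak_lists_def)
      then have "Pin n (?g xs) = S"
        unfolding Pin using fg[OF len[OF xs]] by simp
      moreover have "?g xs permutes {1..n}"
      proof (rule bij_imp_permutes)
        show "bij_betw (?g xs) {1..n} {1..n}"
        proof -
          have "bij_betw (\<lambda>i. i - 1) {1..n} {..<n}"
            by (rule bij_betw_byWitness[where f' = Suc]) auto
          moreover have "bij_betw ((!) xs) {..<n} {1..n}"
            using xs len[OF xs] bij_betw_nth[of xs "{..<n}" "{1..n}"] by (auto simp: peak_lists_def)
          ultimately have "bij_betw ((!) xs \<circ> (\<lambda>i. i - 1)) {1..n} {1..n}"
            by (rule bij_betw_trans)
          then show ?thesis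
            by (rule bij_betw_cong[THEN iffD1, rotated]) auto
        qed
      qed auto
      ultimately show "?g xs permutes {1..n} \<and> Pin n (?g xs) = S" by simp
    qed
  qed
  then show ?thesis
    unfolding pinnacle_count_def by (rule bij_betw_same_card)
qed

section \<open>The number of colored arrangements into \<open>m\<close> blocks\<close>

text \<open>The index is an integer and the value \<open>0\<close> for \<open>m \<le> 0\<close> is a
  convention, so that the recurrence can be unrolled for every integer \<open>m\<close>, including
  the negative indices that it produces.\<close>

definition block_count :: "nat set \<Rightarrow> nat \<Rightarrow> int \<Rightarrow> rat" where
  "block_count S j m = (if m \<le> 0 then 0 else conv_pow (peak_weight S) (nat m) {1..j})"

lemma block_count_0: "block_count S 0 m = (if m \<le> 0 then 0 else 1)"
  by (simp add: block_count_def conv_pow_empty peak_weight_def)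

lemma block_count_Suc_nonpeak:
  assumes "Suc j \<notin> S"
  shows "block_count S (Suc j) m = 2 * of_int m * block_count S j m"
proof -
  have "peak_weight S (insert (Suc j) T) = 2 * peak_weight S T" if "T \<subseteq> {1..j}" for T
    using that assms finite_subset[OF that] by (intro peak_weight_insert_nonpeak) auto
  then show ?thesis
    by (simp add: block_count_def atLeastAtMostSuc_conv conv_pow_insert_double)
qed

text \<open>For \<open>m = 1\<close> the convention \<open>block_count S j 0 = 0\<close> agrees with the value of the empty
  convolution product only if \<open>j > 0\<close>.\<close>

lemma block_count_Suc_peak:
  assumes "Suc j \<in> S" "j > 0"
  shows "block_count S (Suc j) m = of_int m / 2 *
    (block_count S j (m + 1) - 2 * block_count S j m + block_count S j (m - 1))"
proof (cases "m > 0")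
  case True
  define k where "k = nat (m - 1)"
  have k: "nat m = Suc k" "nat (m + 1) = Suc (Suc k)" "nat (m - 1) = k" "m = int (Suc k)"
    using True by (auto simp: k_def)
  have "peak_weight S (insert (Suc j) T) = 1 / 2 * (conv_pow (peak_weight S) 2 T -
      2 * conv_pow (peak_weight S) 1 T + conv_pow (peak_weight S) 0 T)" if "T \<subseteq> {1..j}" for T
    using that assms finite_subset[OF that] by (intro peak_weight_insert_peak) auto
  then have "conv_pow (peak_weight S) (Suc k) (insert (Suc j) {1..j}) = of_nat (Suc k) / 2 *
      (conv_pow (peak_weight S) (Suc (Suc k)) {1..j} - 2 * conv_pow (peak_weight S) (Suc k) {1..j} +
        conv_pow (peak_weight S) k {1..j})"
    by (intro conv_pow_insert_second_difference) auto
  moreover have "conv_pow (peak_weight S) k {1..j} = block_count S j (m - 1)"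
    using assms(2) k True by (cases k) (auto simp: block_count_def)
  moreover have "block_count S j m = conv_pow (peak_weight S) (Suc k) {1..j}"
    "block_count S j (m + 1) = conv_pow (peak_weight S) (Suc (Suc k)) {1..j}"
    "block_count S (Suc j) m = conv_pow (peak_weight S) (Suc k) (insert (Suc j) {1..j})"
    using True k(1,2) by (simp_all add: block_count_def atLeastAtMostSuc_conv del: conv_pow.simps)
  ultimately show ?thesis
    using k(4) by simp
next
  case False
  \<comment> \<open>For \<open>m = 0\<close> the factor \<open>m\<close> removes the possibly
    nonzero term at \<open>m + 1\<close>; for \<open>m < 0\<close> all terms are \<open>0\<close> by
    convention.\<close>
  then show ?thesis
    by (cases "m = 0") (auto simp: block_count_def)
qed

lemma block_count_add:
  assumes "{a<..a + g} \<inter> S = {}"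
  shows "block_count S (a + g) m = (2 * of_int m) ^ g * block_count S a m"
  using assms
proof (induction g)
  case (Suc g)
  have "Suc (a + g) \<in> {a<..a + Suc g}" by simp
  with Suc.prems have "Suc (a + g) \<notin> S" by blast
  moreover have "block_count S (a + g) m = (2 * of_int m) ^ g * block_count S a m"
  proof (rule Suc.IH)
    have "{a<..a + g} \<subseteq> {a<..a + Suc g}" by auto
    with Suc.prems show "{a<..a + g} \<inter> S = {}" by blast
  qed
  ultimately show ?case
    by (simp add: block_count_Suc_nonpeak)
qed simp

text \<open>A single block on the nonempty set \<open>{1..n}\<close> is one list in one of two
  colors.\<close>

lemma pinnacle_count_eq_block_count:
  assumes "n > 0" "S \<subseteq> {1..n}"
  shows "of_nat (pinnacle_count S n) = block_count S n 1 / 2"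
  using assms conv_pow_1[of "{1..n}" "peak_weight S"] pinnacle_count_eq_card_peak_lists[OF assms(2)]
  by (auto simp: block_count_def peak_weight_def)

section \<open>The sequence of pinnacles\<close>

lemma pinn_0: "pinn n S 0 = 0"
  by (simp add: pinn_def)

lemma pinn_last: "pinn n S (Suc (card S)) = Suc n"
  by (simp add: pinn_def nth_append)

lemma pinn_Suc: "i < card S \<Longrightarrow> pinn n S (Suc i) = sorted_list_of_set S ! i"
  by (simp add: pinn_def nth_append)

lemma pinn_in:
  assumes "finite S" "0 < i" "i \<le> card S"
  shows "pinn n S i \<in> S"
proof -
  obtain k where "i = Suc k" "k < card S"
    using assms by (cases i) auto
  then show ?thesis
    using assms(1) nth_mem[of k "sorted_list_of_set S"] by (simp add: pinn_Suc)
qed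

lemma pinn_less_Suc:
  assumes "S \<subseteq> {1..n}" "i \<le> card S"
  shows "pinn n S i < pinn n S (Suc i)"
proof -
  have fin: "finite S" using assms(1) finite_subset by auto
  show ?thesis
  proof (cases "i = 0")
    case True
    then show ?thesis
      using assms pinn_in[OF fin, of "Suc i" n] pinn_last[of n S] pinn_0[of n S]
      by (cases "card S = 0") auto
  next
    case False
    then obtain k where k: "i = Suc k" "k < card S"
      using assms by (cases i) auto
    show ?thesis
    proof (cases "i = card S")
      case True
      then show ?thesis
        using assms(1) pinn_in[OF fin, of i n] False pinn_last[of n S] by force
    next
      case False
      then show ?thesis
        using k assms(2) fin sorted_wrt_nth_less[OF strict_sorted_list_of_set[of S], of k i]
        by (simp add: pinn_Suc)
    qed
  qed
qed

lemma pinn_mono: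
  assumes "S \<subseteq> {1..n}" "i \<le> j" "j \<le> Suc (card S)"
  shows "pinn n S i \<le> pinn n S j"
  using assms(2,3)
proof (induction j rule: dec_induct)
  case (step k)
  then show ?case using pinn_less_Suc[OF assms(1), of k] by simp
qed simp

lemma no_pinn_between:
  assumes "S \<subseteq> {1..n}" "i \<le> card S"
  shows "{pinn n S i<..<pinn n S (Suc i)} \<inter> S = {}"
proof -
  have fin: "finite S" using assms(1) finite_subset by auto
  have False if "x \<in> S" "pinn n S i < x" "x < pinn n S (Suc i)" for x
  proof -
    have "x \<in> set (sorted_list_of_set S)" using that(1) fin by simp
    then obtain k where "k < card S" "x = sorted_list_of_set S ! k"
      by (auto simp: in_set_conv_nth)
    then have k: "x = pinn n S (Suc k)" "k < card S" by (simp_all add: pinn_Suc)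
    show False
    proof (cases "Suc k \<le> i")
      case True
      then show False using pinn_mono[OF assms(1), of "Suc k" i] assms(2) k that by simp
    next
      case False
      then show False using pinn_mono[OF assms(1), of "Suc i" "Suc k"] k that by simp
    qed
  qed
  then show ?thesis by auto
qed

text \<open>The gaps telescope to \<open>(n + 1) - (d + 1)\<close> for \<open>d = card S\<close>.
  This is the number of values that are not pinnacles, each of which contributes a factor
  \<open>2\<close>.\<close>

lemma sum_gap:
  assumes "S \<subseteq> {1..n}"
  shows "int (\<Sum>i\<le>card S. gap n S i) = int n - int (card S)"
proof -
  have gap: "int (gap n S i) = int (pinn n S (Suc i)) - int (pinn n S i) - 1" if "i \<le> card S" for i
    using pinn_less_Suc[OF assms that] by (simp add: gap_def)
  have "int (\<Sum>i<k. gap n S i) = int (pinn n S k) - int k" if "k \<le> Suc (card S)" for k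
    using that by (induction k) (simp_all add: pinn_0 gap)
  from this[of "Suc (card S)"] show ?thesis
    by (simp add: pinn_last lessThan_Suc_atMost)
qed

text \<open>The count just before the pinnacle \<open>s_(i+1)\<close>, when \<open>s_i\<close> and
  all nonpeaks after it are in place. For \<open>i = card S\<close> it is the count at
  \<open>n\<close>.\<close>

definition stage_count :: "nat \<Rightarrow> nat set \<Rightarrow> nat \<Rightarrow> int \<Rightarrow> rat" where
  "stage_count n S i m = block_count S (pinn n S (Suc i) - 1) m"

lemma stage_count_eq:
  assumes "S \<subseteq> {1..n}" "i \<le> card S"
  shows "stage_count n S i m = (2 * of_int m) ^ gap n S i * block_count S (pinn n S i) m"
proof -
  have "pinn n S (Suc i) - 1 = pinn n S i + gap n S i"
    using pinn_less_Suc[OF assms] by (simp add: gap_def)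
  moreover have "{pinn n S i<..pinn n S i + gap n S i} = {pinn n S i<..<pinn n S (Suc i)}"
    using pinn_less_Suc[OF assms] by (auto simp: gap_def)
  ultimately show ?thesis
    using no_pinn_between[OF assms] by (simp add: stage_count_def block_count_add)
qed

lemma stage_count_0:
  assumes "S \<subseteq> {1..n}"
  shows "stage_count n S 0 m = (if m \<le> 0 then 0 else (2 * of_int m) ^ gap n S 0)"
  using stage_count_eq[OF assms, of 0 m] by (simp add: pinn_0 block_count_0)

text \<open>One peak step at \<open>s_(i+1)\<close> is followed by \<open>gap n S (Suc i)\<close>
  nonpeak steps with the same \<open>m\<close>. As \<open>1\<close> is not in \<open>S\<close>, the
  peak step starts from a positive \<open>j\<close>.\<close>

lemma stage_count_Suc:
  assumes "S \<subseteq> {1..n}" "1 \<notin> S" "Suc i \<le> card S"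
  shows "stage_count n S (Suc i) m = (2 * of_int m) ^ gap n S (Suc i) * (of_int m / 2) *
    (stage_count n S i (m + 1) - 2 * stage_count n S i m + stage_count n S i (m - 1))"
proof -
  have fin: "finite S" using assms(1) finite_subset by auto
  have "pinn n S (Suc i) \<in> S"
    using fin assms(3) by (intro pinn_in) auto
  moreover from this have "pinn n S (Suc i) \<noteq> 1" "pinn n S (Suc i) \<ge> 1"
    using assms(1,2) by (metis, force)
  then have "Suc (pinn n S (Suc i) - 1) = pinn n S (Suc i)" "pinn n S (Suc i) - 1 > 0"
    by linarith+
  ultimately show ?thesis
    using block_count_Suc_peak[of "pinn n S (Suc i) - 1" S m] stage_count_eq[OF assms(1,3), of m]
    by (simp add: stage_count_def)
qed

section \<open>Sums over sets of symbols\<close>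

definition level :: "nat \<Rightarrow> nat \<Rightarrow> symbol set \<Rightarrow> int" where
  "level d i B = int d + 1 - int i - int (num_rank_ge B (i + 1))"

lemma num_rank_ge_insert:
  assumes "finite B" "x \<notin> B"
  shows "num_rank_ge (insert x B) i = num_rank_ge B i + (if i \<le> rank x then 1 else 0)"
proof -
  have "{y \<in> insert x B. rank y \<ge> i} =
      (if i \<le> rank x then insert x {y \<in> B. rank y \<ge> i} else {y \<in> B. rank y \<ge> i})"
    by auto
  then show ?thesis
    using assms by (simp add: num_rank_ge_def)
qed

lemma level_insert:
  assumes "finite B" "x \<notin> B"
  shows "level d i (insert x B) = level d i B - (if i < rank x then 1 else 0)"
  using num_rank_ge_insert[OF assms] by (simp add: level_def)

lemma level_eq_card:
  assumes "B \<subseteq> {k..d} \<times> UNIV" "i < k"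
  shows "level d i B = int d + 1 - int i - int (card B)"
proof -
  have "{y \<in> B. rank y \<ge> i + 1} = B"
    using assms by auto
  then show ?thesis by (simp add: level_def num_rank_ge_def)
qed

lemma ranks_insert:
  "k < d \<Longrightarrow> {Suc k..d} \<times> (UNIV :: bool set) =
    insert (Suc k, False) (insert (Suc k, True) ({Suc (Suc k)..d} \<times> UNIV))"
  by (auto simp: Suc_le_eq)

text \<open>In the second difference the symbols of rank \<open>Suc i\<close> in \<open>B\<close> select the term: none, one
  (in two ways) or both give \<open>F i (m + 1)\<close>, \<open>- F i m\<close> and \<open>F i (m - 1)\<close>.\<close>

lemma second_difference_recurrence_unroll:
  fixes F c :: "nat \<Rightarrow> int \<Rightarrow> rat"
  assumes F: "\<And>i m. Suc i \<le> d \<Longrightarrow>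
    F (Suc i) m = c (Suc i) m * (F i (m + 1) - 2 * F i m + F i (m - 1))"
  assumes "k \<le> d"
  shows "F d 1 = (\<Sum>B\<in>Pow ({Suc k..d} \<times> UNIV).
    (- 1) ^ card B * (\<Prod>i=Suc k..d. c i (level d i B)) * F k (level d k B))"
  using assms(2)
proof (induction k rule: inc_induct)
  case base
  \<comment> \<open>The only set is the empty one, and its level at \<open>d\<close> is
    \<open>1\<close>.\<close>
  then show ?case by (simp add: level_def num_rank_ge_def)
next
  case (step k)
  let ?X = "{Suc (Suc k)..d} \<times> (UNIV :: bool set)"
  let ?x = "(Suc k, False)" and ?y = "(Suc k, True)"
  let ?g = "\<lambda>B. (- 1) ^ card B * (\<Prod>i=Suc k..d. c i (level d i B)) * F k (level d k B)"
  have "(- 1) ^ card B * (\<Prod>i=Suc (Suc k)..d. c i (level d i B)) * F (Suc k) (level d (Suc k) B) =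
      ?g B + ?g (insert ?y B) + (?g (insert ?x B) + ?g (insert ?x (insert ?y B)))"
    if B: "B \<in> Pow ?X" for B
  proof -
    have fin: "finite B" using B finite_subset[of B ?X] by auto
    have notin: "?x \<notin> B" "?y \<notin> B" using B by auto
    have prod: "(\<Prod>i=Suc k..d. c i (level d i C)) =
        c (Suc k) (level d (Suc k) B) * (\<Prod>i=Suc (Suc k)..d. c i (level d i B))"
      if "\<And>i. Suc k \<le> i \<Longrightarrow> level d i C = level d i B" for C
    proof -
      have "(\<Prod>i=Suc k..d. c i (level d i C)) = (\<Prod>i=Suc k..d. c i (level d i B))"
        using that by (intro prod.cong) auto
      then show ?thesis
        using prod.atLeast_Suc_atMost[of "Suc k" d "\<lambda>i. c i (level d i B)"] step.hyps by simp
    qed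
    let ?m = "level d (Suc k) B"
    \<comment> \<open>No symbol of \<open>B\<close> has rank \<open>Suc k\<close>, so the levels at
      \<open>k\<close> and \<open>Suc k\<close> differ only through the index.\<close>
    have lev: "level d k B = ?m + 1"
      using B level_eq_card[of B "Suc (Suc k)" d] by auto
    \<comment> \<open>Symbols of rank \<open>Suc k\<close> lower only the levels at indices up to
      \<open>k\<close>, so all four sets share the same product of coefficients.\<close>
    have l1: "level d i (insert ?y B) = level d i B" "level d i (insert ?x B) = level d i B"
      "level d i (insert ?x (insert ?y B)) = level d i B" if "Suc k \<le> i" for i
      using fin notin that by (simp_all add: level_insert)
    have l2: "level d k (insert ?y B) = ?m" "level d k (insert ?x B) = ?m"
      "level d k (insert ?x (insert ?y B)) = ?m - 1"
      using fin notin lev by (simp_all add: level_insert)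
    have card: "card (insert ?y B) = Suc (card B)" "card (insert ?x B) = Suc (card B)"
      "card (insert ?x (insert ?y B)) = Suc (Suc (card B))"
      using fin notin by simp_all
    have p: "(\<Prod>i=Suc k..d. c i (level d i C)) =
        c (Suc k) ?m * (\<Prod>i=Suc (Suc k)..d. c i (level d i B))"
      if "C \<in> {B, insert ?y B, insert ?x B, insert ?x (insert ?y B)}" for C
      using that by (intro prod) (auto simp only: insert_iff empty_iff l1)
    show ?thesis
      unfolding l2 card lev p[of B, simplified] p[of "insert ?y B", simplified]
        p[of "insert ?x B", simplified] p[of "insert ?x (insert ?y B)", simplified]
      using step.hyps by (simp add: F algebra_simps)
  qed
  then have "F d 1 = (\<Sum>B\<in>Pow ?X.
      ?g B + ?g (insert ?y B) + (?g (insert ?x B) + ?g (insert ?x (insert ?y B))))"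
    unfolding step.IH by (rule sum.cong[OF refl])
  also have "\<dots> = (\<Sum>B\<in>Pow (insert ?y ?X). ?g B + ?g (insert ?x B))"
    by (subst sum_Pow_insert) (auto simp: algebra_simps sum.distrib)
  also have "\<dots> = sum ?g (Pow ({Suc k..d} \<times> UNIV))"
    unfolding ranks_insert[OF step.hyps(2)] by (subst sum_Pow_insert) auto
  finally show ?case .
qed

text \<open>For \<open>B \<subseteq> symbols d\<close>, this counts the injective assignments to the
  symbols of \<open>B\<close> of ranks at least their own. Starting from the largest symbol, rank
  \<open>r\<close> leaves \<open>d + 1 - r\<close> choices, of which \<open>i\<close> are already
  taken. The factors drop by at most one per step, so a zero precedes any negative factor.\<close>

definition rank_prod :: "nat \<Rightarrow> symbol set \<Rightarrow> int" where
  "rank_prod d B = (\<Prod>i<card B. int d + 1 - int i - int (rank_nth B (card B - i)))"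

text \<open>The new symbol takes the first position and shifts the others by one. Counted from the
  top nothing changes, and the new factor comes last, with \<open>i = card B\<close>.\<close>

lemma rank_prod_insert_min:
  assumes "finite B" "\<forall>y\<in>B. x < y"
  shows "rank_prod d (insert x B) = rank_prod d B * (int d + 1 - int (card B) - int (rank x))"
proof -
  have x: "x \<notin> B" using assms(2) by auto
  then have "sorted_list_of_set (insert x B) = insort x (sorted_list_of_set B)"
    using assms(1) by simp
  also have "\<dots> = x # sorted_list_of_set B"
    using assms by (intro insort_is_Cons) (auto simp: less_imp_le)
  finally have "rank_nth (insert x B) (Suc j) = (if j = 0 then rank x else rank_nth B j)" for j
    by (cases j) (auto simp: rank_nth_def)
  then show ?thesis
    using assms(1) x by (simp add: rank_prod_def Suc_diff_le)
qed

text \<open>Both sides count the ways to match \<open>B\<close> and \<open>d - card B\<close> unrestricted elements with the ranks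
  so that each element of \<open>B\<close> is matched with a rank at least its own. The induction removes the
  smallest rank, and the case \<open>level d k B \<le> 0\<close> is needed since intermediate levels can vanish.\<close>

lemma rank_prod_fact_aux:
  assumes "k \<le> d" "B \<subseteq> {Suc k..d} \<times> UNIV"
  shows "(level d k B > 0 \<longrightarrow> rank_prod d B * fact (nat (level d k B - 1)) = (\<Prod>i=Suc k..d. level d i B)) \<and>
    (level d k B \<le> 0 \<longrightarrow> rank_prod d B = 0 \<and> (\<Prod>i=Suc k..d. level d i B) * level d k B = 0)"
  using assms
proof (induction k arbitrary: B rule: inc_induct)
  case base
  then show ?case by (simp add: level_def num_rank_ge_def rank_prod_def)
next
  case (step k B)
  let ?X = "{Suc (Suc k)..d} \<times> (UNIV :: bool set)"
  let ?x = "(Suc k, False)" and ?y = "(Suc k, True)"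
  define C where "C = B - {?x, ?y}"
  have C: "C \<subseteq> ?X"
    using step.prems unfolding ranks_insert[OF step.hyps(2)] C_def by auto
  have fin: "finite C" using C finite_subset[of C ?X] by auto
  have notin: "?x \<notin> C" "?y \<notin> C" using C by auto
  have less: "\<forall>y\<in>C. ?x < y" "\<forall>y\<in>C. ?y < y" "?x < ?y"
    using C by (auto simp: less_prod_def)
  let ?m = "level d (Suc k) C"
  have m: "?m = int d + 1 - int (Suc k) - int (card C)"
    by (rule level_eq_card[OF C]) simp
  have lev: "level d k C = ?m + 1"
    using C level_eq_card[of C "Suc (Suc k)" d] by auto
  have IH: "(?m > 0 \<longrightarrow> rank_prod d C * fact (nat (?m - 1)) = (\<Prod>i=Suc (Suc k)..d. level d i C)) \<and>
    (?m \<le> 0 \<longrightarrow> rank_prod d C = 0 \<and> (\<Prod>i=Suc (Suc k)..d. level d i C) * ?m = 0)"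
    by (rule step.IH[OF C])
  have prod: "(\<Prod>i=Suc k..d. level d i B) = ?m * (\<Prod>i=Suc (Suc k)..d. level d i C)"
    if "\<And>i. Suc k \<le> i \<Longrightarrow> level d i B = level d i C"
  proof -
    have "(\<Prod>i=Suc k..d. level d i B) = (\<Prod>i=Suc k..d. level d i C)"
      using that by (intro prod.cong) auto
    then show ?thesis
      using prod.atLeast_Suc_atMost[of "Suc k" d "\<lambda>i. level d i C"] step.hyps by simp
  qed
  \<comment> \<open>A first symbol of rank \<open>Suc k\<close> contributes
    \<open>d + 1 - card C - Suc k\<close>, which is \<open>?m\<close>; a second one finds one more
    symbol above it and contributes \<open>?m - 1\<close>.\<close>
  have y: "rank_prod d (insert ?y C) = rank_prod d C * ?m"
    using rank_prod_insert_min[OF fin less(2)] by (simp add: m algebra_simps)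
  have x: "rank_prod d (insert ?x C) = rank_prod d C * ?m"
    using rank_prod_insert_min[OF fin less(1)] by (simp add: m algebra_simps)
  have xy: "rank_prod d (insert ?x (insert ?y C)) = rank_prod d C * ?m * (?m - 1)"
    using rank_prod_insert_min[of "insert ?y C" ?x d] fin less notin y by (simp add: m algebra_simps)
  have fact_Suc: "fact (nat j) = j * fact (nat (j - 1))" if "j > 0" for j
    using that by (subst fact_num_eq_if) (simp add: nat_diff_distrib')
  consider "B = C" | "B = insert ?y C" | "B = insert ?x C" | "B = insert ?x (insert ?y C)"
    unfolding C_def by blast
  then show ?case
  proof cases
    case 1
    then have "(\<Prod>i=Suc k..d. level d i B) = ?m * (\<Prod>i=Suc (Suc k)..d. level d i C)"
      by (intro prod) simp
    with 1 show ?thesis using IH lev fact_Suc[of ?m]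
      by (cases "?m > 0") (auto simp: ac_simps)
  next
    case 2
    then have p: "(\<Prod>i=Suc k..d. level d i B) = ?m * (\<Prod>i=Suc (Suc k)..d. level d i C)"
      using fin notin by (intro prod) (simp add: level_insert)
    have "level d k B = ?m" using 2 fin notin lev by (simp add: level_insert)
    with 2 p show ?thesis using IH y
      by (cases "?m > 0") (auto simp: ac_simps)
  next
    case 3
    then have p: "(\<Prod>i=Suc k..d. level d i B) = ?m * (\<Prod>i=Suc (Suc k)..d. level d i C)"
      using fin notin by (intro prod) (simp add: level_insert)
    have "level d k B = ?m" using 3 fin notin lev by (simp add: level_insert)
    with 3 p show ?thesis using IH x
      by (cases "?m > 0") (auto simp: ac_simps)
  next
    case 4
    then have p: "(\<Prod>i=Suc k..d. level d i B) = ?m * (\<Prod>i=Suc (Suc k)..d. level d i C)"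
      using fin notin by (intro prod) (simp add: level_insert)
    have l: "level d k B = ?m - 1" using 4 fin notin lev by (simp add: level_insert)
    \<comment> \<open>At \<open>?m = 1\<close> the level reaches \<open>0\<close> although
      \<open>?m\<close> is positive; there the factor \<open>?m - 1\<close> makes
      \<open>rank_prod\<close> vanish.\<close>
    consider "?m \<le> 0" | "?m = 1" | "?m > 1" by linarith
    then show ?thesis
    proof cases
      case a: 3
      then show ?thesis using 4 p l IH xy fact_Suc[of "?m - 1"] by (auto simp: ac_simps)
    qed (use 4 p l IH xy in \<open>auto simp: ac_simps\<close>)
  qed
qed

lemma rank_prod_fact:
  assumes "B \<subseteq> symbols d" "card B \<le> d"
  shows "fact (d - card B) * rank_prod d B = (\<Prod>i=1..d. level d i B)"
proof -
  have "B \<subseteq> {Suc 0..d} \<times> UNIV"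
    using assms(1) by (simp add: symbols_def)
  moreover from this have "level d 0 B = int d + 1 - int (card B)"
    using level_eq_card[of B "Suc 0" d 0] by simp
  ultimately show ?thesis
    using rank_prod_fact_aux[of 0 d B] assms(2) by (simp add: mult.commute nat_diff_distrib')
qed

text \<open>A pinnacle exceeds its left neighbour, which is at least \<open>1\<close>.\<close>

lemma one_notin_admissible:
  assumes "admissible_pinnacle_set S"
  shows "1 \<notin> S"
proof
  assume "1 \<in> S"
  then obtain m \<pi> where \<pi>: "\<pi> permutes {1..m}" and "1 \<in> Pin m \<pi>"
    using assms unfolding admissible_pinnacle_set_def by blast
  then obtain i where i: "1 = \<pi> i" "2 \<le> i" "i \<le> m - 1" "\<pi> (i - 1) < \<pi> i"
    unfolding Pin_def by blast
  have "i - 1 \<in> {1..m}" using i by auto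
  then have "\<pi> (i - 1) \<in> {1..m}" using permutes_in_image[OF \<pi>] by blast
  then show False using i by auto
qed

section \<open>Collecting powers of two and discarding the sets with vanishing initial value\<close>

theorem theorem4p1:
  fixes n d :: nat and S :: "nat set"
  assumes "n > 0" and "S \<subseteq> {1..n}" and "d = card S"
    and "admissible_pinnacle_set S"
  shows "(of_nat (pinnacle_count S n) :: rat) =
    2 powi (int n - 2 * int d - 1) *
    of_int (\<Sum>B | B \<subseteq> symbols d \<and> card B \<le> d.
      (- 1) ^ card B * fact (d - card B) *
      (\<Prod>i<card B. int d + 1 - int i - int (rank_nth B (card B - i))) *
      (\<Prod>i\<le>d. (int d + 1 - int i - int (num_rank_ge B (i + 1))) ^ gap n S i))"
proof -
  let ?F = "stage_count n S"
  let ?c = "\<lambda>i m. (2 * of_int m) ^ gap n S i * (of_int m / 2) :: rat"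
  let ?t = "\<lambda>B. (- 1) ^ card B * (\<Prod>i=1..d. ?c i (level d i B)) * ?F 0 (level d 0 B)"
  let ?s = "\<lambda>B. (- 1) ^ card B * fact (d - card B) * rank_prod d B * (\<Prod>i\<le>d. level d i B ^ gap n S i)"
  have fin: "finite (symbols d)" by (simp add: symbols_def)
  \<comment> \<open>The exponent has one factor \<open>2\<close> for each nonpinnacle, one factor
    \<open>1/2\<close> for each pinnacle, and a last \<open>1/2\<close> for the two colors.\<close>
  have "int n - 2 * int d - 1 = int (\<Sum>i\<le>d. gap n S i) - int (Suc d)"
    using sum_gap[OF assms(2)] assms(3) by simp
  then have two: "2 powi (int n - 2 * int d - 1) = (2 :: rat) ^ (\<Sum>i\<le>d. gap n S i) / 2 ^ Suc d"
    by (simp only: power_int_diff power_int_of_nat zero_neq_numeral[symmetric] simp_thms)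
  \<comment> \<open>The leading \<open>2\<close> undoes the last halving, since
    \<open>?F d 1\<close> is twice the number of permutations.\<close>
  have t: "?t B = 2 * 2 powi (int n - 2 * int d - 1) * of_int (?s B)"
    if B: "B \<subseteq> symbols d" "card B \<le> d" for B
  proof -
    have "level d 0 B > 0"
      using B level_eq_card[of B 1 d 0] by (simp add: symbols_def)
    then have "?F 0 (level d 0 B) = (2 * of_int (level d 0 B)) ^ gap n S 0"
      using stage_count_0[OF assms(2)] by simp
    \<comment> \<open>The initial value of the recurrence supplies the factor for
      \<open>i = 0\<close>.\<close>
    moreover have "(\<Prod>i\<le>d. (2 * of_int (level d i B)) ^ gap n S i) =
        (2 * of_int (level d 0 B)) ^ gap n S 0 * (\<Prod>i=1..d. (2 * of_int (level d i B) :: rat) ^ gap n S i)"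
      by (simp add: atMost_atLeast0 prod.atLeast_Suc_atMost)
    ultimately have "?t B = (- 1) ^ card B * (\<Prod>i=1..d. of_int (level d i B) / 2) *
        (\<Prod>i\<le>d. (2 * of_int (level d i B)) ^ gap n S i)"
      by (simp only: prod.distrib ac_simps)
    also have "(\<Prod>i=1..d. of_int (level d i B) / 2) = (of_int (\<Prod>i=1..d. level d i B) :: rat) / 2 ^ d"
      by (simp add: prod_dividef)
    also have "(\<Prod>i=1..d. level d i B) = fact (d - card B) * rank_prod d B"
      using rank_prod_fact[OF B] by simp
    also have "(\<Prod>i\<le>d. (2 * of_int (level d i B) :: rat) ^ gap n S i) =
        2 ^ (\<Sum>i\<le>d. gap n S i) * of_int (\<Prod>i\<le>d. level d i B ^ gap n S i)"
      by (simp add: power_mult_distrib prod.distrib power_sum)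
    finally show ?thesis unfolding two by simp
  qed
  \<comment> \<open>Here the restriction \<open>card B \<le> d\<close> arises: a larger
    \<open>B\<close> leads to an index \<open>level d 0 B \<le> 0\<close>, where the initial value
    is \<open>0\<close>.\<close>
  have zero: "?t B = 0" if B: "B \<subseteq> symbols d" "\<not> card B \<le> d" for B
  proof -
    have "level d 0 B \<le> 0"
      using B level_eq_card[of B 1 d 0] by (simp add: symbols_def)
    then show ?thesis using stage_count_0[OF assms(2)] by simp
  qed
  have "of_nat (pinnacle_count S n) = ?F d 1 / 2"
    using pinnacle_count_eq_block_count[OF assms(1,2)] assms(3) pinn_last[of n S]
    by (simp add: stage_count_def)
  also have "?F d 1 = (\<Sum>B\<in>Pow (symbols d). ?t B)"
    using second_difference_recurrence_unroll[of d ?F ?c 0]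
      stage_count_Suc[OF assms(2) one_notin_admissible[OF assms(4)]] assms(3)
    by (simp add: symbols_def)
  also have "\<dots> = (\<Sum>B | B \<subseteq> symbols d \<and> card B \<le> d. ?t B)"
    using fin zero by (intro sum.mono_neutral_right) auto
  also have "\<dots> = (\<Sum>B | B \<subseteq> symbols d \<and> card B \<le> d. 2 * 2 powi (int n - 2 * int d - 1) * of_int (?s B))"
    by (intro sum.cong) (use t in auto)
  also have "\<dots> / 2 = 2 powi (int n - 2 * int d - 1) *
      of_int (\<Sum>B | B \<subseteq> symbols d \<and> card B \<le> d. ?s B)"
    unfolding of_int_sum by (simp only: mult.assoc sum_distrib_left[symmetric])
  finally show ?thesis unfolding rank_prod_def level_def .
qed

end
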